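(* There exists a polynomial $P$ in three variables (absolute, independent of all quantities below) such that the following holds. Let $0<\Delta<\sqrt2/2$ and $\alpha>0$, and let $(v_1,b_1),\ldots,(v_k,b_k)\in\mathbb{R}^d\times\mathbb{R}$ be pairwise $(\Delta,\alpha)$-close. Let $[k]=S_1\sqcup S_2$ be the orientation induced by them. Define $B=\max_i|b_i|$ and $R=\max_i\|v_i\|$, and let $s_1,\ldots,s_k\in\{\pm1\}$. Define $$F(x)=\sum_{i=1}^k s_i\,\sigma(\langle v_i,x\rangle-b_i),\qquad v^*=\sum_{i\in S_1}s_iv_i-\sum_{i\in S_2}s_iv_i,\qquad b^*=\sum_{i\in S_1}s_ib_i-\sum_{i\in S_2}s_ib_i.$$ Then at least one of the following holds: 1. There is an affine linear function $\ell:\mathbb{R}^d\to\mathbb{R}$ for which $\|F-\ell\|^2\le P(k,R,B)\cdot(\alpha^{1/2}+\Delta^{2/9})$. 2. There exist $a^+,a^-\in\mathbb{R}$ for which $G(x)=a^+\sigma(\langle v^*,x\rangle-b^* )-a^-\sigma(\langle -v^*,x\rangle+b^* )$ satisfies $\|F-G\|^2\le P(k,R,B)\cdot(\Delta^{2/5}+\alpha^2\Delta^{-4/9})$.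
   Context: $\sigma(z)=\max(z,0)$. For $h:\mathbb{R}^d\to\mathbb{R}$ square-integrable with respect to the standard Gaussian measure, $\|h\|=\mathbb{E}_{x\sim\mathcal{N}(0,\mathrm{Id})}[h(x)^2]^{1/2}$; for vectors $\|\cdot\|$ is the Euclidean norm. For nonzero vectors, $\angle(v,v')=\arccos\frac{\langle v,v'\rangle}{\|v\|\|v'\|}$. Pairs $(v,b),(v',b')\in\mathbb{R}^d\times\mathbb{R}$ (with $v,v'\neq0$) are called $(\Delta,\alpha)$-close if $|\sin\angle(v,v')|\le\Delta$ and $\|bv'-b'v\|\le\alpha\|v\|\|v'\|$. If $\Delta<\sqrt2/2$ and $(v_1,b_1),\ldots,(v_k,b_k)$ are pairwise $(\Delta,\alpha)$-close, there is a partition $[k]=S_1\sqcup S_2$ (unique up to swapping $S_1$ and $S_2$; one part may be empty) such that $\langle v_i,v_j\rangle\ge0$ whenever $i,j$ lie in the same part and $\langle v_i,v_j\rangle<0$ whenever they lie in different parts; it is called the orientation induced by $\{(v_i,b_i)\}$. *)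

theory Defs
  imports "HOL-Probability.Probability" "HOL-Computational_Algebra.Polynomial"
begin

(* The dimension d is quantified below an existential (the polynomial must not depend on it),
   so it cannot be a type.  A vector of R^d is a function nat => real of which only the
   coordinates j < d are ever read; its Euclidean norm is the library's L2_set. *)

definition dot :: "nat \<Rightarrow> (nat \<Rightarrow> real) \<Rightarrow> (nat \<Rightarrow> real) \<Rightarrow> real" where
  "dot d v w = (\<Sum>j<d. v j * w j)"

abbreviation vnorm :: "nat \<Rightarrow> (nat \<Rightarrow> real) \<Rightarrow> real" where
  "vnorm d v \<equiv> L2_set v {..<d}"

definition nonzero_vec :: "nat \<Rightarrow> (nat \<Rightarrow> real) \<Rightarrow> bool" where
  "nonzero_vec d v \<longleftrightarrow> (\<exists>j<d. v j \<noteq> 0)"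

definition vec_angle :: "nat \<Rightarrow> (nat \<Rightarrow> real) \<Rightarrow> (nat \<Rightarrow> real) \<Rightarrow> real" where
  "vec_angle d v w = arccos (dot d v w / (vnorm d v * vnorm d w))"

definition relu :: "real \<Rightarrow> real" where
  "relu z = max z 0"

definition affine_linear :: "nat \<Rightarrow> ((nat \<Rightarrow> real) \<Rightarrow> real) \<Rightarrow> bool" where
  "affine_linear d l \<longleftrightarrow> (\<exists>w c. \<forall>x. l x = dot d w x + c)"

definition std_gaussian :: "nat \<Rightarrow> (nat \<Rightarrow> real) measure" where
  "std_gaussian d = (\<Pi>\<^sub>M j\<in>{..<d}. std_normal_distribution)"

(* Meaningful for square-integrable h only: the Bochner integral is 0 when h^2 is not integrable.
   Finite sums of affine functions composed with relu grow linearly and are square-integrable. *)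
definition gauss_norm :: "nat \<Rightarrow> ((nat \<Rightarrow> real) \<Rightarrow> real) \<Rightarrow> real" where
  "gauss_norm d h = sqrt (\<integral>x. (h x)\<^sup>2 \<partial>std_gaussian d)"

definition close ::
    "nat \<Rightarrow> real \<Rightarrow> real \<Rightarrow> (nat \<Rightarrow> real) \<times> real \<Rightarrow> (nat \<Rightarrow> real) \<times> real \<Rightarrow> bool" where
  "close d \<Delta> \<alpha> = (\<lambda>(v, b) (v', b').
     nonzero_vec d v \<and> nonzero_vec d v' \<and>
     \<bar>sin (vec_angle d v v')\<bar> \<le> \<Delta> \<and>
     vnorm d (\<lambda>j. b * v' j - b' * v j) \<le> \<alpha> * vnorm d v * vnorm d v')"

(* The orientation is unique only up to swapping the two parts, hence a predicate. *)
definition is_orientation ::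
    "nat \<Rightarrow> nat \<Rightarrow> (nat \<Rightarrow> nat \<Rightarrow> real) \<Rightarrow> nat set \<Rightarrow> nat set \<Rightarrow> bool" where
  "is_orientation d k v S\<^sub>1 S\<^sub>2 \<longleftrightarrow>
     S\<^sub>1 \<union> S\<^sub>2 = {..<k} \<and> S\<^sub>1 \<inter> S\<^sub>2 = {} \<and>
     (\<forall>i\<in>S\<^sub>1. \<forall>j\<in>S\<^sub>1. dot d (v i) (v j) \<ge> 0) \<and>
     (\<forall>i\<in>S\<^sub>2. \<forall>j\<in>S\<^sub>2. dot d (v i) (v j) \<ge> 0) \<and>
     (\<forall>i\<in>S\<^sub>1. \<forall>j\<in>S\<^sub>2. dot d (v i) (v j) < 0)"

(* A polynomial in three variables is an element of R[z][y][x]; x belongs to the outermost poly. *)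
definition poly3 :: "real poly poly poly \<Rightarrow> real \<Rightarrow> real \<Rightarrow> real \<Rightarrow> real" where
  "poly3 P x y z = poly (poly (poly P [:[:x:]:]) [:y:]) z"

end

theory Submission
  imports Defs
begin

text \<open>
  Reflecting the pairs indexed by the second part makes all vectors point into one half space.
  Closeness then says that each affine form is, up to an \<open>L\<^sup>2\<close> error of order \<open>R (\<Delta> + \<alpha>)\<close>, its
  own norm \<open>r\<^sub>i\<close> times a single normalised form \<open>z\<close>, here that of the first pair.  As the ReLU is
  1-Lipschitz, \<open>F\<close> is close to \<open>A \<sigma>(z) + C \<sigma>(-z)\<close>, where \<open>A\<close> and \<open>C\<close> are the sums of \<open>s\<^sub>i r\<^sub>i\<close> over the
  two parts, while the form given by \<open>v\<^sup>*\<close> and \<open>b\<^sup>*\<close> is close to \<open>(A + C) z\<close>.  If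
  \<open>\<bar>A + C\<bar> \<le> \<Delta>\<^bsup>1/9\<^esup>\<close> the two slopes nearly agree and \<open>F\<close> is nearly affine; otherwise \<open>z\<close> may be
  replaced by a multiple of that form, at the cost of a factor \<open>1 + k R / \<bar>A + C\<bar>\<close>.  The
  kink of \<open>\<sigma>(\<langle>u,x\<rangle> - c)\<close> costs at most \<open>\<bar>\<langle>u,x\<rangle>\<bar>\<close> when the affine comparison function is chosen
  according to the sign of \<open>c\<close>, so the size of the normalised offset \<open>c\<close>, which is not controlled
  by \<open>R\<close> and \<open>B\<close>, never enters.
\<close>

section \<open>Euclidean geometry of linear combinations\<close>

text \<open>Scaling, subtraction and negation are all obtained from this one shape, by putting 0 or
  1 for some of the coefficients.\<close>

lemma dot_lincomb_left: "dot d (\<lambda>j. a * v j - c * w j) x = a * dot d v x - c * dot d w x"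
  by (simp add: dot_def algebra_simps sum_subtractf sum_distrib_left)

lemma dot_commute: "dot d v w = dot d w v"
  by (simp add: dot_def mult.commute)

lemma vnorm_sq: "(vnorm d v)\<^sup>2 = dot d v v"
  by (simp add: L2_set_def dot_def sum_nonneg power2_eq_square)

lemma vnorm_lincomb_sq:
  "(vnorm d (\<lambda>j. a * v j - c * w j))\<^sup>2
    = a\<^sup>2 * (vnorm d v)\<^sup>2 + c\<^sup>2 * (vnorm d w)\<^sup>2 - 2 * a * c * dot d v w"
  unfolding vnorm_sq dot_lincomb_left
  by (simp add: dot_commute[of d _ "\<lambda>j. a * v j - c * w j"] dot_lincomb_left dot_commute[of d w v]
      algebra_simps power2_eq_square)

lemma abs_dot_le: "\<bar>dot d v w\<bar> \<le> vnorm d v * vnorm d w"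
proof -
  have "\<bar>dot d v w\<bar> \<le> (\<Sum>j<d. \<bar>v j\<bar> * \<bar>w j\<bar>)"
    unfolding dot_def by (metis (no_types, lifting) abs_mult sum_abs sum.cong)
  also have "\<dots> \<le> vnorm d v * vnorm d w"
    by (rule L2_set_mult_ineq)
  finally show ?thesis .
qed

lemma vnorm_pos: "nonzero_vec d v \<Longrightarrow> 0 < vnorm d v"
  unfolding nonzero_vec_def
  by (metis L2_set_eq_0_iff L2_set_nonneg finite_lessThan lessThan_iff order_le_less)

section \<open>Gaussian moments and the L2 size of affine forms\<close>

text \<open>A product of coordinates is a monomial, and its integral over the product measure
  factors into one-dimensional moments; only the orders 0, 1 and 2 occur.\<close>

lemma has_bochner_integral_std_gaussian_coord:
  assumes "i < d"
  shows "has_bochner_integral (std_gaussian d) (\<lambda>x. x i) 0"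
    and has_bochner_integral_std_gaussian_coord_mult:
      "j < d \<Longrightarrow> has_bochner_integral (std_gaussian d) (\<lambda>x. x i * x j) (of_bool (i = j))"
proof -
  interpret product_sigma_finite "\<lambda>_::nat. std_normal_distribution"
    by (intro product_sigma_finite.intro prob_space_imp_sigma_finite prob_space_normal_density) simp
  have int: "integrable std_normal_distribution (\<lambda>x. x ^ n)" for n
    using integrable_std_normal_distribution_moment .
  have moment0: "(\<integral>x. x ^ 0 \<partial>std_normal_distribution) = (1::real)"
    using std_normal_distribution_even_moments[of 0] by simp
  have moment1: "(\<integral>x. x ^ 1 \<partial>std_normal_distribution) = (0::real)"
    by (rule integral_std_normal_distribution_moment_odd) simp
  have moment2: "(\<integral>x. x ^ 2 \<partial>std_normal_distribution) = (1::real)"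
    using std_normal_distribution_even_moments[of 1] by simp
  have monomial: "has_bochner_integral (std_gaussian d) (\<lambda>x. \<Prod>l<d. x l ^ e l)
      (\<Prod>l<d. \<integral>x. x ^ e l \<partial>std_normal_distribution)" for e :: "nat \<Rightarrow> nat"
    using product_integrable_prod[OF finite_lessThan int, of d e]
      product_integral_prod[OF finite_lessThan int, of d e]
    by (simp add: has_bochner_integral_iff std_gaussian_def)
  \<comment> \<open>Exponents of the monomial \<open>x i\<close>; the factor at \<open>i\<close> is
    the vanishing first moment.\<close>
  define e1 :: "nat \<Rightarrow> nat" where "e1 l = of_bool (l = i)" for l
  have "(\<Prod>l<d. x l ^ e1 l) = x i" for x :: "nat \<Rightarrow> real"
  proof -
    have "(\<Prod>l<d. x l ^ e1 l) = (\<Prod>l<d. if l = i then x l else 1)"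
      by (intro prod.cong) (auto simp: e1_def)
    then show ?thesis using assms by simp
  qed
  moreover have "(\<Prod>l<d. \<integral>x. x ^ e1 l \<partial>std_normal_distribution) = (0::real)"
    using assms moment1 by (intro prod_zero) (auto simp: e1_def intro!: bexI[of _ i])
  ultimately show "has_bochner_integral (std_gaussian d) (\<lambda>x. x i) 0"
    using monomial[of e1] by (simp only:)
  assume "j < d"
  \<comment> \<open>Exponents of \<open>x i * x j\<close>: the value is 2 at \<open>i\<close> when
    \<open>i = j\<close>; otherwise the exponent 1 at \<open>i\<close> again produces a zero
    factor.\<close>
  define e2 :: "nat \<Rightarrow> nat" where "e2 l = of_bool (l = i) + of_bool (l = j)" for l
  have "(\<Prod>l<d. x l ^ e2 l) = x i * x j" for x :: "nat \<Rightarrow> real"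
  proof -
    have "(\<Prod>l<d. x l ^ e2 l)
        = (\<Prod>l<d. (if l = i then x l else 1) * (if l = j then x l else 1))"
      by (intro prod.cong) (auto simp: e2_def)
    then show ?thesis using assms \<open>j < d\<close> by (simp add: prod.distrib)
  qed
  moreover have "(\<Prod>l<d. \<integral>x. x ^ e2 l \<partial>std_normal_distribution) = (of_bool (i = j) :: real)"
  proof (cases "i = j")
    case True
    have "(\<integral>x. x ^ e2 l \<partial>std_normal_distribution) = (1::real)" for l
    proof (cases "l = i")
      case True
      then have "e2 l = 2" using \<open>i = j\<close> by (simp add: e2_def)
      then show ?thesis using moment2 by simp
    next
      case False
      then have "e2 l = 0" using \<open>i = j\<close> by (simp add: e2_def)
      then show ?thesis using moment0 by simp
    qed
    then show ?thesis using True by simp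
  next
    case False
    then have "(\<Prod>l<d. \<integral>x. x ^ e2 l \<partial>std_normal_distribution) = (0::real)"
      using assms moment1 by (intro prod_zero) (auto simp: e2_def intro!: bexI[of _ i])
    then show ?thesis using False by simp
  qed
  ultimately show "has_bochner_integral (std_gaussian d) (\<lambda>x. x i * x j) (of_bool (i = j))"
    using monomial[of e2] by (simp only:)
qed

text \<open>The coordinates are centred and orthonormal in L2, so expanding the square leaves only
  the diagonal terms and the constant.\<close>

lemma has_bochner_integral_std_gaussian_affine_sq:
  "has_bochner_integral (std_gaussian d) (\<lambda>x. (dot d w x - c)\<^sup>2) ((vnorm d w)\<^sup>2 + c\<^sup>2)"
proof -
  interpret prob_space "std_gaussian d"
    unfolding std_gaussian_def by (intro prob_space_PiM prob_space_normal_density) simp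
  have expand: "(dot d w x - c)\<^sup>2
      = (\<Sum>i<d. \<Sum>j<d. w i * w j * (x i * x j)) - (\<Sum>i<d. 2 * c * w i * x i) + c\<^sup>2" for x
    by (simp add: dot_def power2_diff power2_eq_square sum_product sum_distrib_left sum_distrib_right
        algebra_simps)
  have "has_bochner_integral (std_gaussian d) (\<lambda>x. c\<^sup>2) (c\<^sup>2)"
    by (simp add: has_bochner_integral_iff prob_space)
  then have "has_bochner_integral (std_gaussian d) (\<lambda>x. (dot d w x - c)\<^sup>2)
      ((\<Sum>i<d. \<Sum>j<d. w i * w j * of_bool (i = j)) - (\<Sum>i<d. 2 * c * w i * 0) + c\<^sup>2)"
    unfolding expand
    by (intro has_bochner_integral_add has_bochner_integral_diff has_bochner_integral_sum
        has_bochner_integral_mult_right has_bochner_integral_std_gaussian_coord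
        has_bochner_integral_std_gaussian_coord_mult) auto
  also have "(\<Sum>i<d. \<Sum>j<d. w i * w j * of_bool (i = j)) = (vnorm d w)\<^sup>2"
    unfolding vnorm_sq dot_def by (intro sum.cong) (auto simp: of_bool_def if_distrib cong: if_cong)
  finally show ?thesis by simp
qed

text \<open>Cauchy-Schwarz for the finite sum costs the factor \<open>n\<close> and reduces the
  claim to second moments of affine forms. Every pointwise estimate below enters
  \<open>gauss_norm\<close> through this lemma.\<close>

lemma gauss_norm_sq_le:
  assumes "\<And>x. \<bar>h x\<bar> \<le> m * (\<Sum>i<n. \<bar>dot d (w i) x - c i\<bar>)"
    and "\<And>i. i < n \<Longrightarrow> (vnorm d (w i))\<^sup>2 + (c i)\<^sup>2 \<le> C i"
  shows "(gauss_norm d h)\<^sup>2 \<le> m\<^sup>2 * real n * (\<Sum>i<n. C i)"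
proof -
  let ?g = "\<lambda>x. m\<^sup>2 * real n * (\<Sum>i<n. (dot d (w i) x - c i)\<^sup>2)"
  have le: "(h x)\<^sup>2 \<le> ?g x" for x
  proof -
    have "(h x)\<^sup>2 \<le> (m * (\<Sum>i<n. \<bar>dot d (w i) x - c i\<bar>))\<^sup>2"
      using assms(1)[of x] by (metis abs_ge_zero power2_abs power_mono)
    also have "\<dots> \<le> m\<^sup>2 * (real n * (\<Sum>i<n. (dot d (w i) x - c i)\<^sup>2))"
      unfolding power_mult_distrib
      using sum_squared_le_sum_of_squares[of "\<lambda>i. \<bar>dot d (w i) x - c i\<bar>" "{..<n}"]
      by (intro mult_left_mono) (auto simp: mult.commute)
    finally show ?thesis by (simp add: mult.assoc)
  qed
  have int: "has_bochner_integral (std_gaussian d) ?g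
      (m\<^sup>2 * real n * (\<Sum>i<n. (vnorm d (w i))\<^sup>2 + (c i)\<^sup>2))"
    by (intro has_bochner_integral_mult_right has_bochner_integral_sum
        has_bochner_integral_std_gaussian_affine_sq)
  have "(\<integral>x. (h x)\<^sup>2 \<partial>std_gaussian d) \<le> (\<integral>x. ?g x \<partial>std_gaussian d)"
  \<comment> \<open>Integrability is asked of the dominating function only: a non-integrable square
    would have integral 0, which lies below the nonnegative right-hand side.\<close>
  proof (rule integral_mono')
    show "integrable (std_gaussian d) ?g"
      using int by (simp add: has_bochner_integral_iff)
    show "0 \<le> ?g x" for x
      by (intro mult_nonneg_nonneg sum_nonneg) auto
  qed (rule le)
  also have "\<dots> = m\<^sup>2 * real n * (\<Sum>i<n. (vnorm d (w i))\<^sup>2 + (c i)\<^sup>2)"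
    using int by (simp only: has_bochner_integral_iff)
  also have "\<dots> \<le> m\<^sup>2 * real n * (\<Sum>i<n. C i)"
    using assms(2) by (intro mult_left_mono sum_mono) auto
  finally show ?thesis
    by (simp add: gauss_norm_def)
qed

section \<open>ReLU estimates and quantitative consequences of closeness\<close>

lemma relu_lipschitz: "\<bar>relu a - relu b\<bar> \<le> \<bar>a - b\<bar>"
  by (auto simp: relu_def)

lemma relu_mult: "0 \<le> r \<Longrightarrow> relu (r * a) = r * relu a"
  by (simp add: relu_def max_mult_distrib_left)

text \<open>With \<open>t\<close> the cosine of the angle, the sine bound reads
  \<open>1 - t^2 \<le> \<Delta>^2\<close>; clearing denominators removes the angle from all later
  arguments.\<close>

lemma close_dot_sq:
  assumes "close d \<Delta> \<alpha> (v, b) (w, c)"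
  shows "(vnorm d v * vnorm d w)\<^sup>2 - (dot d v w)\<^sup>2 \<le> \<Delta>\<^sup>2 * (vnorm d v * vnorm d w)\<^sup>2"
proof -
  define r where "r = vnorm d v * vnorm d w"
  define t where "t = dot d v w / r"
  have sin: "\<bar>sin (arccos t)\<bar> \<le> \<Delta>" and r: "0 < r"
    using assms by (auto simp: close_def vec_angle_def r_def t_def vnorm_pos)
  have t: "\<bar>t\<bar> \<le> 1"
    using abs_dot_le[of d v w] r by (simp add: t_def r_def[symmetric] abs_divide)
  then have "(sin (arccos t))\<^sup>2 = 1 - t\<^sup>2"
    by (simp add: sin_arccos_abs abs_square_le_1)
  moreover have "(sin (arccos t))\<^sup>2 \<le> \<Delta>\<^sup>2"
    using sin by (metis abs_ge_zero power2_abs power_mono)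
  ultimately have "r\<^sup>2 * (1 - t\<^sup>2) \<le> r\<^sup>2 * \<Delta>\<^sup>2"
    by (intro mult_left_mono) auto
  moreover have "r * t = dot d v w"
    using r by (simp add: t_def)
  ultimately show ?thesis
    by (simp add: r_def[symmetric] algebra_simps flip: power_mult_distrib)
qed

lemma close_offset_sq:
  assumes "close d \<Delta> \<alpha> (v, b) (w, c)"
  shows "b\<^sup>2 * (vnorm d w)\<^sup>2 + c\<^sup>2 * (vnorm d v)\<^sup>2 - 2 * b * c * dot d v w
    \<le> \<alpha>\<^sup>2 * (vnorm d v * vnorm d w)\<^sup>2"
proof -
  have "vnorm d (\<lambda>j. b * w j - c * v j) \<le> \<alpha> * (vnorm d v * vnorm d w)"
    using assms by (simp add: close_def mult.assoc)
  then have "(vnorm d (\<lambda>j. b * w j - c * v j))\<^sup>2 \<le> (\<alpha> * (vnorm d v * vnorm d w))\<^sup>2"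
    by (rule power_mono) simp
  then show ?thesis
    by (simp add: vnorm_lincomb_sq dot_commute[of d w v] power_mult_distrib)
qed


text \<open>The factor \<open>q\<close> reflects \<open>w\<close> by \<open>f\<close> and rescales
  it to the length of \<open>v\<close>. The sine bound alone cannot tell parallel from antiparallel
  vectors; the sign hypothesis excludes the latter, so the two vectors of equal length are
  close.\<close>

lemma close_rescaled:
  assumes "close d \<Delta> \<alpha> (v, b) (w, c)"
    and signs: "e \<in> {1, -1}" "f \<in> {1, -1}" and oriented: "0 \<le> e * f * dot d v w"
  defines "q \<equiv> vnorm d v * (f / vnorm d w)"
  shows "(vnorm d (\<lambda>j. e * v j - q * w j))\<^sup>2 + (e * b - q * c)\<^sup>2
    \<le> 2 * (vnorm d v)\<^sup>2 * (\<Delta>\<^sup>2 + \<alpha>\<^sup>2)"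
proof -
  define r where "r = vnorm d v"
  define \<rho> where "\<rho> = vnorm d w"
  define p where "p = e * f * dot d v w"
  have pos: "0 < r" "0 < \<rho>"
    using assms(1) by (auto simp: close_def r_def \<rho>_def vnorm_pos)
  have ef: "e\<^sup>2 = 1" "f\<^sup>2 = 1" "(e * f)\<^sup>2 = 1"
    using signs by auto
  have p: "0 \<le> p" "p \<le> r * \<rho>"
    using oriented signs abs_dot_le[of d v w] by (auto simp: p_def r_def \<rho>_def)
  \<comment> \<open>As \<open>p\<close> is nonnegative, the second factor of the difference of
    squares is at least \<open>r * \<rho>\<close>, which can then be cancelled.\<close>
  have "(r * \<rho> - p) * (r * \<rho>) \<le> (r * \<rho> - p) * (r * \<rho> + p)"
    using p by (intro mult_left_mono) auto
  also have "\<dots> \<le> \<Delta>\<^sup>2 * (r * \<rho>) * (r * \<rho>)"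
    using close_dot_sq[OF assms(1)] signs
    by (auto simp: p_def r_def \<rho>_def algebra_simps power2_eq_square)
  finally have angle: "r * \<rho> - p \<le> \<Delta>\<^sup>2 * (r * \<rho>)"
    using pos by (simp add: mult_le_cancel_right)
  have "(vnorm d (\<lambda>j. e * v j - q * w j))\<^sup>2 = 2 * (r / \<rho>) * (r * \<rho> - p)"
    using pos ef
    unfolding vnorm_lincomb_sq
    by (simp add: q_def r_def[symmetric] \<rho>_def[symmetric] p_def power_mult_distrib power_divide)
       (simp add: field_simps power2_eq_square)
  also have "\<dots> \<le> 2 * (r / \<rho>) * (\<Delta>\<^sup>2 * (r * \<rho>))"
    using angle pos by (intro mult_left_mono) auto
  also have "\<dots> = 2 * r\<^sup>2 * \<Delta>\<^sup>2"
    using pos by (simp add: power2_eq_square)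
  finally have vec: "(vnorm d (\<lambda>j. e * v j - q * w j))\<^sup>2 \<le> 2 * r\<^sup>2 * \<Delta>\<^sup>2" .

  define x where "x = e * b * \<rho>"
  define y where "y = f * c * r"
  \<comment> \<open>Comparing offsets by the sign of \<open>b * c\<close> avoids an error of order \<open>\<Delta> * \<bar>c\<bar> / \<rho>\<close>, which is not
    polynomial in the bounds since \<open>\<rho>\<close> may be tiny.\<close>
  define K where "K = e * f * b * c"
  have xy: "x\<^sup>2 + y\<^sup>2 - 2 * (K * p) \<le> \<alpha>\<^sup>2 * (r * \<rho>)\<^sup>2"
    using close_offset_sq[OF assms(1)] signs
    by (auto simp: K_def x_def y_def p_def r_def \<rho>_def algebra_simps power_mult_distrib)
  have "(x - y)\<^sup>2 \<le> 2 * (x\<^sup>2 + y\<^sup>2 - 2 * (K * p))"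
  proof (cases "0 \<le> K")
    case True
    then have "K * p \<le> K * (r * \<rho>)"
      using p by (intro mult_left_mono)
    then have "K * p \<le> x * y"
      by (simp add: K_def x_def y_def mult_ac)
    then have "(x - y)\<^sup>2 \<le> x\<^sup>2 + y\<^sup>2 - 2 * (K * p)"
      unfolding power2_diff by simp
    then show ?thesis
      using zero_le_power2[of "x - y"] by argo
  next
    case False
    \<comment> \<open>The right-hand side is now at least \<open>2 * (x^2 + y^2)\<close>, the sum of
      \<open>(x - y)^2\<close> and \<open>(x + y)^2\<close>.\<close>
    then have "K * p \<le> 0"
      using p by (simp add: mult_nonpos_nonneg)
    then show ?thesis
      using zero_le_power2[of "x + y"] unfolding power2_diff power2_sum by argo
  qed
  also have "\<dots> \<le> 2 * (\<alpha>\<^sup>2 * (r * \<rho>)\<^sup>2)"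
    using xy by simp
  finally have "(x - y)\<^sup>2 / \<rho>\<^sup>2 \<le> 2 * (\<alpha>\<^sup>2 * (r * \<rho>)\<^sup>2) / \<rho>\<^sup>2"
    by (intro divide_right_mono) auto
  moreover have "(x - y) / \<rho> = e * b - q * c"
    using pos by (simp add: x_def y_def q_def r_def[symmetric] \<rho>_def[symmetric] field_simps)
  ultimately have "(e * b - q * c)\<^sup>2 \<le> 2 * r\<^sup>2 * \<alpha>\<^sup>2"
    using pos by (simp add: power_divide[symmetric] power_mult_distrib mult_ac)
  with vec show ?thesis
    by (simp add: r_def algebra_simps)
qed

lemma relu_sum_approx:
  fixes s r y :: "'a \<Rightarrow> real"
  assumes "finite S" "finite S'" "S \<inter> S' = {}"
    and "\<And>i. i \<in> S \<union> S' \<Longrightarrow> \<bar>s i\<bar> = 1" and "\<And>i. i \<in> S \<union> S' \<Longrightarrow> 0 \<le> r i"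
  defines "g \<equiv> (\<lambda>i. if i \<in> S then 1 else -1)"
  shows "\<bar>(\<Sum>i\<in>S \<union> S'. s i * relu (y i))
      - ((\<Sum>i\<in>S. s i * r i) * relu z + (\<Sum>i\<in>S'. s i * r i) * relu (- z))\<bar>
    \<le> (\<Sum>i\<in>S \<union> S'. \<bar>g i * y i - r i * z\<bar>)" (is ?relu)
    and "\<bar>((\<Sum>i\<in>S. s i * y i) - (\<Sum>i\<in>S'. s i * y i))
      - ((\<Sum>i\<in>S. s i * r i) + (\<Sum>i\<in>S'. s i * r i)) * z\<bar>
    \<le> (\<Sum>i\<in>S \<union> S'. \<bar>g i * y i - r i * z\<bar>)" (is ?linear)
proof -
  have split: "(\<Sum>i\<in>S. h i) + (\<Sum>i\<in>S'. h' i) = (\<Sum>i\<in>S \<union> S'. if i \<in> S then h i else h' i)"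
    for h h' :: "'a \<Rightarrow> real"
    unfolding sum.union_disjoint[OF assms(1-3)] using assms(3)
    by (intro arg_cong2[of _ _ _ _ "(+)"] sum.cong) auto
  have bound: "\<bar>\<Sum>i\<in>S \<union> S'. s i * h i\<bar> \<le> (\<Sum>i\<in>S \<union> S'. \<bar>g i * y i - r i * z\<bar>)"
    if "\<And>i. i \<in> S \<union> S' \<Longrightarrow> \<bar>h i\<bar> \<le> \<bar>g i * y i - r i * z\<bar>" for h
  proof -
    have "\<bar>\<Sum>i\<in>S \<union> S'. s i * h i\<bar> \<le> (\<Sum>i\<in>S \<union> S'. \<bar>s i * h i\<bar>)"
      by (rule sum_abs)
    also have "\<dots> \<le> (\<Sum>i\<in>S \<union> S'. \<bar>g i * y i - r i * z\<bar>)"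
      using that assms(4) by (intro sum_mono) (simp add: abs_mult)
    finally show ?thesis .
  qed
  \<comment> \<open>The sign \<open>g i\<close> selects \<open>relu z\<close> on \<open>S\<close>
    and \<open>relu (- z)\<close> on \<open>S'\<close>.\<close>
  have "(\<Sum>i\<in>S. s i * r i) * relu z + (\<Sum>i\<in>S'. s i * r i) * relu (- z)
      = (\<Sum>i\<in>S \<union> S'. s i * (r i * relu (g i * z)))"
    unfolding sum_distrib_right split by (intro sum.cong) (auto simp: g_def)
  then have "(\<Sum>i\<in>S \<union> S'. s i * relu (y i))
      - ((\<Sum>i\<in>S. s i * r i) * relu z + (\<Sum>i\<in>S'. s i * r i) * relu (- z))
      = (\<Sum>i\<in>S \<union> S'. s i * (relu (y i) - r i * relu (g i * z)))"
    by (simp add: sum_subtractf right_diff_distrib)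
  moreover have "\<bar>relu (y i) - r i * relu (g i * z)\<bar> \<le> \<bar>g i * y i - r i * z\<bar>" if "i \<in> S \<union> S'" for i
    using relu_lipschitz[of "y i" "r i * (g i * z)"] relu_mult[of "r i" "g i * z"] assms(5)[OF that]
    by (auto simp: g_def split: if_splits)
  ultimately show ?relu
    using bound by simp
  have "((\<Sum>i\<in>S. s i * y i) - (\<Sum>i\<in>S'. s i * y i))
      - ((\<Sum>i\<in>S. s i * r i) + (\<Sum>i\<in>S'. s i * r i)) * z
      = ((\<Sum>i\<in>S. s i * y i) + (\<Sum>i\<in>S'. - (s i * y i)))
      - ((\<Sum>i\<in>S. s i * r i) + (\<Sum>i\<in>S'. s i * r i)) * z"
    by (simp add: sum_negf)
  also have "\<dots> = (\<Sum>i\<in>S \<union> S'. s i * (g i * y i - r i * z))"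
    unfolding split sum_distrib_right sum_subtractf[symmetric]
    by (intro sum.cong) (auto simp: g_def algebra_simps)
  finally show ?linear
    using bound by simp
qed

text \<open>By positive homogeneity the two-piece function of \<open>z\<close> is a function
  \<open>h\<close> of \<open>\<bar>A + C\<bar> * z\<close> with slopes divided by
  \<open>\<bar>A + C\<bar>\<close>; the Lipschitz constant of \<open>h\<close> is the price of
  replacing its argument. The constants \<open>p\<close> and \<open>m\<close> depend on
  \<open>A\<close> and \<open>C\<close> only.\<close>

lemma two_piece_rescale:
  fixes A C :: real
  assumes "A + C \<noteq> 0"
  obtains p m where "\<And>y z. \<bar>(A * relu z + C * relu (- z)) - (p * relu y - m * relu (- y))\<bar>
    \<le> (\<bar>A\<bar> + \<bar>C\<bar>) / \<bar>A + C\<bar> * \<bar>y - (A + C) * z\<bar>"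
proof -
  define T where "T = A + C"
  define h where "h z = A / \<bar>T\<bar> * relu z + C / \<bar>T\<bar> * relu (- z)" for z
  have T: "\<bar>T\<bar> > 0"
    using assms by (simp add: T_def)
  have h: "A * relu z + C * relu (- z) = h (\<bar>T\<bar> * z)" for z
    using T relu_mult[of "\<bar>T\<bar>" z] relu_mult[of "\<bar>T\<bar>" "- z"] by (simp add: h_def)
  have h_lipschitz: "\<bar>h x - h y\<bar> \<le> (\<bar>A\<bar> + \<bar>C\<bar>) / \<bar>T\<bar> * \<bar>x - y\<bar>" for x y
  proof -
    have "\<bar>h x - h y\<bar>
        = \<bar>A / \<bar>T\<bar> * (relu x - relu y) + C / \<bar>T\<bar> * (relu (- x) - relu (- y))\<bar>"
      by (simp add: h_def algebra_simps)
    also have "\<dots> \<le> \<bar>A\<bar> / \<bar>T\<bar> * \<bar>relu x - relu y\<bar> + \<bar>C\<bar> / \<bar>T\<bar> * \<bar>relu (- x) - relu (- y)\<bar>"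
      by (rule order_trans[OF abs_triangle_ineq]) (simp add: abs_mult)
    also have "\<dots> \<le> \<bar>A\<bar> / \<bar>T\<bar> * \<bar>x - y\<bar> + \<bar>C\<bar> / \<bar>T\<bar> * \<bar>x - y\<bar>"
      using relu_lipschitz[of x y] relu_lipschitz[of "- x" "- y"]
      by (intro add_mono mult_left_mono) auto
    finally show ?thesis by (simp add: add_divide_distrib algebra_simps)
  qed
  show thesis
  proof (cases "T > 0")
    case True
    show thesis
    proof (rule that[of "A / T" "- (C / T)"])
      fix y z
      show "\<bar>(A * relu z + C * relu (- z)) - (A / T * relu y - - (C / T) * relu (- y))\<bar>
          \<le> (\<bar>A\<bar> + \<bar>C\<bar>) / \<bar>A + C\<bar> * \<bar>y - (A + C) * z\<bar>"
        using h_lipschitz[of "T * z" y] True h[of z]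
        by (simp add: h_def[of y] T_def[symmetric] abs_minus_commute)
    qed
  next
    case False
    then have "T < 0" using T by auto
    show thesis
    \<comment> \<open>For negative \<open>T\<close> the argument \<open>\<bar>T\<bar> * z\<close> is
      \<open>- (T * z)\<close>, compared with \<open>- y\<close>, so the two branches exchange their
      slopes.\<close>
    proof (rule that[of "- (C / T)" "A / T"])
      fix y z
      have "\<bar>- (T * z) - (- y)\<bar> = \<bar>y - T * z\<bar>"
        by simp
      then show "\<bar>(A * relu z + C * relu (- z)) - (- (C / T) * relu y - A / T * relu (- y))\<bar>
          \<le> (\<bar>A\<bar> + \<bar>C\<bar>) / \<bar>A + C\<bar> * \<bar>y - (A + C) * z\<bar>"
        using h_lipschitz[of "- (T * z)" "- y"] \<open>T < 0\<close> h[of z]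
        by (simp add: h_def[of "- y"] T_def[symmetric] algebra_simps)
    qed
  qed
qed

lemma affine_linear_affine: "affine_linear d (\<lambda>x. a * (dot d u x - c))"
  unfolding affine_linear_def
  by (intro exI[of _ "\<lambda>j. a * u j"] exI[of _ "- (a * c)"])
     (simp add: dot_def sum_distrib_left algebra_simps)

text \<open>With \<open>z = dot d u x - c\<close>, the function equals both
  \<open>- C * z + (A + C) * relu z\<close> and \<open>A * z + (A + C) * relu (- z)\<close>. The
  sign of \<open>c\<close> decides which ReLU term is bounded by
  \<open>\<bar>dot d u x\<bar>\<close>.\<close>

lemma two_piece_near_affine:
  obtains l where "affine_linear d l"
    and "\<And>x. \<bar>(A * relu (dot d u x - c) + C * relu (- (dot d u x - c))) - l x\<bar>
      \<le> \<bar>A + C\<bar> * \<bar>dot d u x\<bar>"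
proof -
  have relu_minus: "relu (- z) = relu z - z" for z
    by (simp add: relu_def)
  show thesis
  proof (cases "0 \<le> c")
    case True
    show thesis
    proof (rule that[OF affine_linear_affine[of d "- C" u c]])
      fix x
      have "\<bar>(A + C) * relu (dot d u x - c)\<bar> \<le> \<bar>A + C\<bar> * \<bar>dot d u x\<bar>"
        unfolding abs_mult using True by (intro mult_left_mono) (auto simp: relu_def)
      then show "\<bar>(A * relu (dot d u x - c) + C * relu (- (dot d u x - c)))
          - - C * (dot d u x - c)\<bar> \<le> \<bar>A + C\<bar> * \<bar>dot d u x\<bar>"
        unfolding relu_minus by (simp add: algebra_simps)
    qed
  next
    case False
    show thesis
    proof (rule that[OF affine_linear_affine[of d A u c]])
      fix x
      have "\<bar>(A + C) * relu (- (dot d u x - c))\<bar> \<le> \<bar>A + C\<bar> * \<bar>dot d u x\<bar>"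
        unfolding abs_mult using False by (intro mult_left_mono) (auto simp: relu_def)
      then show "\<bar>(A * relu (dot d u x - c) + C * relu (- (dot d u x - c)))
          - A * (dot d u x - c)\<bar> \<le> \<bar>A + C\<bar> * \<bar>dot d u x\<bar>"
        unfolding relu_minus by (simp add: algebra_simps)
    qed
  qed
qed


section \<open>Numerical bounds in the two slope regimes\<close>

text \<open>On the unit interval smaller exponents give larger powers. The threshold exponent 1/9 is
  the one whose square is the \<open>\<Delta> powr (2/9)\<close> of the first alternative.\<close>

lemma bound_small_slope:
  fixes k R \<Delta> \<alpha> T :: real
  assumes "0 < \<Delta>" "\<Delta> \<le> 1" "0 < \<alpha>" "\<alpha> \<le> 1" "\<bar>T\<bar> \<le> \<Delta> powr (1/9)" "0 \<le> k"
  shows "(k + 1) * (k * (2 * R\<^sup>2 * (\<Delta>\<^sup>2 + \<alpha>\<^sup>2)) + T\<^sup>2)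
    \<le> (k + 1) * (2 * k * R\<^sup>2 + 1) * (\<alpha> powr (1/2) + \<Delta> powr (2/9))"
proof -
  let ?q = "\<alpha> powr (1/2) + \<Delta> powr (2/9)"
  have "\<Delta>\<^sup>2 = \<Delta> powr 2" "\<alpha>\<^sup>2 = \<alpha> powr 2"
    using assms by simp_all
  moreover have "\<Delta> powr 2 \<le> \<Delta> powr (2/9)" "\<alpha> powr 2 \<le> \<alpha> powr (1/2)"
    using powr_mono'[of "2/9" 2 \<Delta>] powr_mono'[of "1/2" 2 \<alpha>] assms by simp_all
  ultimately have "\<Delta>\<^sup>2 + \<alpha>\<^sup>2 \<le> ?q"
    by linarith
  then have "k * (2 * R\<^sup>2 * (\<Delta>\<^sup>2 + \<alpha>\<^sup>2)) \<le> k * (2 * R\<^sup>2 * ?q)"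
    using assms by (intro mult_left_mono) auto
  moreover have "T\<^sup>2 \<le> (\<Delta> powr (1/9))\<^sup>2"
    using assms(5) by (metis abs_ge_zero power2_abs power_mono)
  then have "T\<^sup>2 \<le> \<Delta> powr (2/9)"
    by (simp add: power2_eq_square flip: powr_add)
  then have "T\<^sup>2 \<le> ?q"
    by (smt (verit) powr_ge_zero)
  ultimately have "k * (2 * R\<^sup>2 * (\<Delta>\<^sup>2 + \<alpha>\<^sup>2)) + T\<^sup>2 \<le> k * (2 * R\<^sup>2 * ?q) + ?q"
    by (rule add_mono)
  also have "\<dots> = (2 * k * R\<^sup>2 + 1) * ?q"
    by (simp add: algebra_simps)
  finally show ?thesis
    using assms(6) unfolding mult.assoc[of "k + 1"] by (intro mult_left_mono) auto
qed

text \<open>Dividing by the slope costs \<open>\<Delta> powr (- (2/9))\<close> after squaring.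
  Against \<open>\<Delta>^2\<close> this leaves exponent 16/9, more than 2/5; against
  \<open>\<alpha>^2\<close> it stays below the permitted
  \<open>\<Delta> powr (- (4/9))\<close>.\<close>

lemma bound_large_slope:
  fixes k R \<Delta> \<alpha> T K :: real
  assumes "0 < \<Delta>" "\<Delta> \<le> 1" "\<Delta> powr (1/9) < \<bar>T\<bar>" "0 \<le> K" "K \<le> k * R" "0 \<le> k"
  shows "(1 + K / \<bar>T\<bar>)\<^sup>2 * k * (k * (2 * R\<^sup>2 * (\<Delta>\<^sup>2 + \<alpha>\<^sup>2)))
    \<le> 4 * (1 + k\<^sup>2 * R\<^sup>2) * k\<^sup>2 * R\<^sup>2 * (\<Delta> powr (2/5) + \<alpha>\<^sup>2 * \<Delta> powr (- (4/9)))"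
proof -
  let ?\<tau> = "\<Delta> powr (1/9)" and ?\<mu> = "\<Delta> powr (- (2/9))"
  have \<tau>: "0 < ?\<tau>" "?\<tau>\<^sup>2 * ?\<mu> = 1"
    using assms(1) by (simp_all add: power2_eq_square flip: powr_add)
  have \<mu>: "1 \<le> ?\<mu>"
    using powr_mono'[of "- (2/9)" 0 \<Delta>] assms by simp
  have "(K / \<bar>T\<bar>)\<^sup>2 \<le> (k * R / ?\<tau>)\<^sup>2"
    using assms \<tau> by (intro power_mono frac_le) auto
  also have "\<dots> = k\<^sup>2 * R\<^sup>2 * ?\<mu>"
    using \<tau> by (simp add: power_divide power_mult_distrib divide_eq_eq)
       (simp add: mult_ac)
  finally have ratio: "(K / \<bar>T\<bar>)\<^sup>2 \<le> k\<^sup>2 * R\<^sup>2 * ?\<mu>" .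
  have "(1 + K / \<bar>T\<bar>)\<^sup>2 \<le> 2 * (1 + (K / \<bar>T\<bar>)\<^sup>2)"
    using zero_le_power2[of "1 - K / \<bar>T\<bar>"] unfolding power2_sum power2_diff by simp
  \<comment> \<open>The bound \<open>1 \<le> ?\<mu>\<close> lets the summand 1 be absorbed into the
    same power.\<close>
  also have "\<dots> \<le> 2 * (?\<mu> + k\<^sup>2 * R\<^sup>2 * ?\<mu>)"
    using ratio \<mu> by simp
  finally have factor: "(1 + K / \<bar>T\<bar>)\<^sup>2 \<le> 2 * (1 + k\<^sup>2 * R\<^sup>2) * ?\<mu>"
    by (simp add: algebra_simps)
  have "?\<mu> * \<Delta>\<^sup>2 = \<Delta> powr (- (2/9)) * \<Delta> powr 2"
    using assms by simp
  also have "\<dots> = \<Delta> powr (16/9)"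
    by (simp flip: powr_add)
  also have "\<dots> \<le> \<Delta> powr (2/5)"
    using assms by (intro powr_mono') auto
  finally have "?\<mu> * \<Delta>\<^sup>2 \<le> \<Delta> powr (2/5)" .
  moreover have "\<alpha>\<^sup>2 * ?\<mu> \<le> \<alpha>\<^sup>2 * \<Delta> powr (- (4/9))"
    using assms by (intro mult_left_mono powr_mono') auto
  ultimately have small: "?\<mu> * (\<Delta>\<^sup>2 + \<alpha>\<^sup>2) \<le> \<Delta> powr (2/5) + \<alpha>\<^sup>2 * \<Delta> powr (- (4/9))"
    by (simp add: algebra_simps)
  have "(1 + K / \<bar>T\<bar>)\<^sup>2 * k * (k * (2 * R\<^sup>2 * (\<Delta>\<^sup>2 + \<alpha>\<^sup>2)))
      = (1 + K / \<bar>T\<bar>)\<^sup>2 * (2 * k\<^sup>2 * R\<^sup>2 * (\<Delta>\<^sup>2 + \<alpha>\<^sup>2))"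
    by (simp add: power2_eq_square mult_ac)
  also have "\<dots> \<le> 2 * (1 + k\<^sup>2 * R\<^sup>2) * ?\<mu> * (2 * k\<^sup>2 * R\<^sup>2 * (\<Delta>\<^sup>2 + \<alpha>\<^sup>2))"
    using factor by (intro mult_right_mono) auto
  also have "\<dots> = 4 * (1 + k\<^sup>2 * R\<^sup>2) * k\<^sup>2 * R\<^sup>2 * (?\<mu> * (\<Delta>\<^sup>2 + \<alpha>\<^sup>2))"
    by (simp add: mult_ac)
  also have "\<dots> \<le> 4 * (1 + k\<^sup>2 * R\<^sup>2) * k\<^sup>2 * R\<^sup>2 * (\<Delta> powr (2/5) + \<alpha>\<^sup>2 * \<Delta> powr (- (4/9)))"
    using small by (intro mult_left_mono) (auto intro!: mult_nonneg_nonneg add_nonneg_nonneg)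
  finally show ?thesis .
qed

section \<open>Approximation of the whole network\<close>

text \<open>Each neuron is replaced separately by its affine form or by 0, according to the sign of
  its offset, with error at most \<open>\<bar>dot d (v i) x\<bar>\<close>. This crude bound serves
  the case \<open>\<alpha> > 1\<close>.\<close>

lemma relu_network_near_affine:
  assumes s: "\<And>i. i < k \<Longrightarrow> \<bar>s i\<bar> = 1" and R: "\<And>i. i < k \<Longrightarrow> vnorm d (v i) \<le> R"
  obtains l where "affine_linear d l"
    and "(gauss_norm d (\<lambda>x. (\<Sum>i<k. s i * relu (dot d (v i) x - b i)) - l x))\<^sup>2
      \<le> real k * (real k * R\<^sup>2)"
proof -
  define l where "l x = (\<Sum>i<k. s i * (of_bool (b i < 0) * (dot d (v i) x - b i)))" for x
  have "affine_linear d l"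
    unfolding affine_linear_def
  proof (intro exI allI)
    fix x
    show "l x = dot d (\<lambda>j. \<Sum>i<k. s i * of_bool (b i < 0) * v i j) x
        + (\<Sum>i<k. - (s i * of_bool (b i < 0) * b i))"
      unfolding l_def dot_def sum_distrib_right sum.swap[of _ "{..<k}" "{..<d}"]
      by (simp add: sum.distrib[symmetric] sum_distrib_left algebra_simps sum_subtractf)
  qed
  moreover have "\<bar>(\<Sum>i<k. s i * relu (dot d (v i) x - b i)) - l x\<bar>
      \<le> 1 * (\<Sum>i<k. \<bar>dot d (v i) x - 0\<bar>)" for x
  proof -
    have "\<bar>(\<Sum>i<k. s i * relu (dot d (v i) x - b i)) - l x\<bar>
        = \<bar>\<Sum>i<k. s i * (relu (dot d (v i) x - b i) - of_bool (b i < 0) * (dot d (v i) x - b i))\<bar>"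
      unfolding l_def sum_subtractf[symmetric] right_diff_distrib ..
    also have "\<dots> \<le> (\<Sum>i<k. \<bar>dot d (v i) x\<bar>)"
      using s by (intro order_trans[OF sum_abs] sum_mono) (auto simp: abs_mult relu_def)
    finally show ?thesis by simp
  qed
  then have "(gauss_norm d (\<lambda>x. (\<Sum>i<k. s i * relu (dot d (v i) x - b i)) - l x))\<^sup>2
      \<le> 1\<^sup>2 * real k * (\<Sum>i<k. R\<^sup>2)"
    by (rule gauss_norm_sq_le) (use R in \<open>auto intro!: power_mono\<close>)
  ultimately show thesis
    using that by simp
qed

text \<open>One error sum controls both \<open>F\<close> against the two-piece function
  \<open>H\<close> and the form of \<open>vs\<close> and \<open>bs\<close> against
  \<open>A + C\<close> times the normalised first form. The size of \<open>A + C\<close> then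
  decides which alternative is proved, with explicit bounds.\<close>

lemma close_relu_network_approx:
  fixes s :: "nat \<Rightarrow> real"
  assumes \<Delta>: "0 < \<Delta>" "\<Delta> \<le> 1" and \<alpha>: "0 < \<alpha>" and k: "1 \<le> k"
    and nz: "\<And>i. i < k \<Longrightarrow> nonzero_vec d (v i)"
    and close: "pairwise (\<lambda>i j. close d \<Delta> \<alpha> (v i, b i) (v j, b j)) {..<k}"
    and orient: "is_orientation d k v S S'"
    and s: "\<And>i. i < k \<Longrightarrow> \<bar>s i\<bar> = 1" and R: "\<And>i. i < k \<Longrightarrow> vnorm d (v i) \<le> R"
  defines "F \<equiv> (\<lambda>x. \<Sum>i<k. s i * relu (dot d (v i) x - b i))"
    and "vs \<equiv> (\<lambda>j. (\<Sum>i\<in>S. s i * v i j) - (\<Sum>i\<in>S'. s i * v i j))"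
    and "bs \<equiv> (\<Sum>i\<in>S. s i * b i) - (\<Sum>i\<in>S'. s i * b i)"
  shows "(\<exists>l. affine_linear d l \<and>
      (gauss_norm d (\<lambda>x. F x - l x))\<^sup>2
        \<le> (real k + 1) * (2 * real k * R\<^sup>2 + 1) * (\<alpha> powr (1/2) + \<Delta> powr (2/9))) \<or>
    (\<exists>p m. (gauss_norm d (\<lambda>x. F x - (p * relu (dot d vs x - bs) - m * relu (- (dot d vs x - bs)))))\<^sup>2
        \<le> 4 * (1 + (real k)\<^sup>2 * R\<^sup>2) * (real k)\<^sup>2 * R\<^sup>2
          * (\<Delta> powr (2/5) + \<alpha>\<^sup>2 * \<Delta> powr (- (4/9))))"
proof -
  define r where "r i = vnorm d (v i)" for i
  define g :: "nat \<Rightarrow> real" where "g i = (if i \<in> S then 1 else -1)" for i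
  \<comment> \<open>The form \<open>dot d u x - c\<close> is that of the first pair, reflected by
    \<open>g 0\<close> and scaled to a unit vector.\<close>
  define u where "u = (\<lambda>j. g 0 / r 0 * v 0 j)"
  define c where "c = g 0 / r 0 * b 0"
  \<comment> \<open>\<open>w i\<close> and \<open>e i\<close> are the coefficients of the error form
    of neuron \<open>i\<close>, as \<open>err\<close> confirms.\<close>
  define w where "w i j = g i * v i j - r i * (g 0 / r 0) * v 0 j" for i j
  define e where "e i = g i * b i - r i * (g 0 / r 0) * b 0" for i
  define A where "A = (\<Sum>i\<in>S. s i * r i)"
  define C where "C = (\<Sum>i\<in>S'. s i * r i)"
  define H where "H x = A * relu (dot d u x - c) + C * relu (- (dot d u x - c))" for x
  have SS': "S \<union> S' = {..<k}" "S \<inter> S' = {}"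
    and same: "\<And>i j. i \<in> S \<Longrightarrow> j \<in> S \<Longrightarrow> 0 \<le> dot d (v i) (v j)"
      "\<And>i j. i \<in> S' \<Longrightarrow> j \<in> S' \<Longrightarrow> 0 \<le> dot d (v i) (v j)"
    and diff: "\<And>i j. i \<in> S \<Longrightarrow> j \<in> S' \<Longrightarrow> dot d (v i) (v j) < 0"
    using orient by (auto simp: is_orientation_def)
  have fin: "finite S" "finite S'"
    using SS' by (metis finite_Un finite_lessThan)+
  have r: "0 < r i" if "i < k" for i
    using nz[OF that] by (simp add: r_def vnorm_pos)
  have dot_u: "dot d u x = g 0 / r 0 * dot d (v 0) x" for x
    unfolding u_def dot_def by (simp add: sum_distrib_left mult.assoc)
  have err: "g i * (dot d (v i) x - b i) - r i * (dot d u x - c) = dot d (w i) x - e i" for i x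
    unfolding w_def dot_lincomb_left dot_u c_def e_def by (simp add: algebra_simps)
  have w_le: "(vnorm d (w i))\<^sup>2 + (e i)\<^sup>2 \<le> 2 * R\<^sup>2 * (\<Delta>\<^sup>2 + \<alpha>\<^sup>2)" if "i < k" for i
  proof -
    have "(vnorm d (w i))\<^sup>2 + (e i)\<^sup>2 \<le> 2 * (r i)\<^sup>2 * (\<Delta>\<^sup>2 + \<alpha>\<^sup>2)"
    proof (cases "i = 0")
      \<comment> \<open>Pairwise closeness says nothing about a pair and itself; at index 0 the
        error form vanishes identically.\<close>
      case True
      then have "w i = (\<lambda>_. 0)" "e i = 0"
        using r[OF that] by (auto simp: w_def e_def)
      then show ?thesis by (simp add: L2_set_def)
    next
      case False
      then have "close d \<Delta> \<alpha> (v i, b i) (v 0, b 0)"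
        using close that k by (auto simp: pairwise_def)
      moreover have "0 \<le> g i * g 0 * dot d (v i) (v 0)"
      proof -
        have "i \<in> S \<union> S'" "0 \<in> S \<union> S'"
          using SS'(1) that k by auto
        then show ?thesis
          using same[of i 0] diff[of i 0] diff[of 0 i] SS'(2)
          by (auto simp: g_def dot_commute[of d "v i"])
      qed
      ultimately show ?thesis
        unfolding w_def e_def r_def by (intro close_rescaled) (auto simp: g_def)
    qed
    also have "\<dots> \<le> 2 * R\<^sup>2 * (\<Delta>\<^sup>2 + \<alpha>\<^sup>2)"
      using R[OF that] r[OF that]
      by (intro mult_right_mono mult_left_mono power_mono) (auto simp: r_def)
    finally show ?thesis .
  qed
  have FH: "\<bar>F x - H x\<bar> \<le> (\<Sum>i<k. \<bar>dot d (w i) x - e i\<bar>)"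
    and lin: "\<bar>(dot d vs x - bs) - (A + C) * (dot d u x - c)\<bar> \<le> (\<Sum>i<k. \<bar>dot d (w i) x - e i\<bar>)"
    for x
  proof -
    note approx = relu_sum_approx[OF fin SS'(2), of s r "\<lambda>i. dot d (v i) x - b i" "dot d u x - c",
        unfolded SS'(1) g_def[symmetric] err A_def[symmetric] C_def[symmetric]]
    show "\<bar>F x - H x\<bar> \<le> (\<Sum>i<k. \<bar>dot d (w i) x - e i\<bar>)"
      unfolding F_def H_def using approx(1) s r by (auto intro: less_imp_le)
    have part: "dot d (\<lambda>j. \<Sum>i\<in>I. s i * v i j) x = (\<Sum>i\<in>I. s i * dot d (v i) x)" for I
      unfolding dot_def sum_distrib_right sum_distrib_left
      by (subst sum.swap) (simp add: mult.assoc)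
    have "dot d vs x - bs
        = (\<Sum>i\<in>S. s i * (dot d (v i) x - b i)) - (\<Sum>i\<in>S'. s i * (dot d (v i) x - b i))"
      using dot_lincomb_left[of d 1 "\<lambda>j. \<Sum>i\<in>S. s i * v i j" 1 "\<lambda>j. \<Sum>i\<in>S'. s i * v i j" x]
      by (simp add: vs_def bs_def part right_diff_distrib sum_subtractf)
    then show "\<bar>(dot d vs x - bs) - (A + C) * (dot d u x - c)\<bar> \<le> (\<Sum>i<k. \<bar>dot d (w i) x - e i\<bar>)"
      using approx(2) s r by (auto intro: less_imp_le)
  qed
  show ?thesis
  proof (cases "\<bar>A + C\<bar> \<le> \<Delta> powr (1/9)")
    case small: True
    show ?thesis
    \<comment> \<open>Comparing \<open>\<alpha>^2\<close> with \<open>\<alpha> powr (1/2)\<close>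
      requires \<open>\<alpha> \<le> 1\<close>; for larger \<open>\<alpha>\<close> the factor on the
      right is at least 1 and the neuron-wise affine bound suffices.\<close>
    proof (cases "\<alpha> \<le> 1")
      case True
      obtain l where l: "affine_linear d l"
        and Hl: "\<And>x. \<bar>H x - l x\<bar> \<le> \<bar>A + C\<bar> * \<bar>dot d u x\<bar>"
        using two_piece_near_affine[of d A u c C] unfolding H_def by metis
      \<comment> \<open>The slope error is appended at index \<open>k\<close> as one more affine
        form, with offset 0, so that a single application of \<open>gauss_norm_sq_le\<close> with
        \<open>Suc k\<close> terms covers both errors.\<close>
      define w' where "w' i = (if i < k then w i else (\<lambda>j. (A + C) * u j))" for i
      define e' where "e' i = (if i < k then e i else 0)" for i
      define D where "D i = (if i < k then 2 * R\<^sup>2 * (\<Delta>\<^sup>2 + \<alpha>\<^sup>2) else (A + C)\<^sup>2)" for i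
      have "vnorm d u = 1"
      proof -
        have "(vnorm d u)\<^sup>2 = (g 0 / r 0)\<^sup>2 * (r 0)\<^sup>2"
          using vnorm_lincomb_sq[of "g 0 / r 0" "v 0" 0 "v 0" d] by (simp add: u_def r_def)
        then have "(vnorm d u)\<^sup>2 = 1\<^sup>2"
          using r[of 0] k by (simp add: g_def field_simps)
        then show ?thesis
          by (rule power2_eq_imp_eq) (simp_all add: L2_set_nonneg)
      qed
      then have "(vnorm d (\<lambda>j. (A + C) * u j))\<^sup>2 = (A + C)\<^sup>2"
        using vnorm_lincomb_sq[of "A + C" u 0 u d] by simp
      then have D: "(vnorm d (w' i))\<^sup>2 + (e' i)\<^sup>2 \<le> D i" for i
        using w_le by (auto simp: w'_def e'_def D_def)
      have "\<bar>F x - l x\<bar> \<le> 1 * (\<Sum>i<Suc k. \<bar>dot d (w' i) x - e' i\<bar>)" for x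
      proof -
        have "(\<Sum>i<Suc k. \<bar>dot d (w' i) x - e' i\<bar>)
            = (\<Sum>i<k. \<bar>dot d (w i) x - e i\<bar>) + \<bar>A + C\<bar> * \<bar>dot d u x\<bar>"
          using dot_lincomb_left[of d "A + C" u 0 u x]
          by (simp add: w'_def e'_def abs_mult)
        then show ?thesis
          using FH[of x] Hl[of x] by linarith
      qed
      then have "(gauss_norm d (\<lambda>x. F x - l x))\<^sup>2 \<le> 1\<^sup>2 * real (Suc k) * (\<Sum>i<Suc k. D i)"
        by (rule gauss_norm_sq_le) (rule D)
      also have "\<dots> = (real k + 1) * (real k * (2 * R\<^sup>2 * (\<Delta>\<^sup>2 + \<alpha>\<^sup>2)) + (A + C)\<^sup>2)"
        by (simp add: D_def)
      also have "\<dots> \<le> (real k + 1) * (2 * real k * R\<^sup>2 + 1) * (\<alpha> powr (1/2) + \<Delta> powr (2/9))"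
        using \<Delta> \<alpha> True small by (intro bound_small_slope) auto
      finally show ?thesis
        using l by blast
    next
      case False
      obtain l where l: "affine_linear d l"
        and le: "(gauss_norm d (\<lambda>x. F x - l x))\<^sup>2 \<le> real k * (real k * R\<^sup>2)"
        unfolding F_def by (rule relu_network_near_affine[of k s v d R b, OF s R])
      note le
      also have "real k * (real k * R\<^sup>2) \<le> (real k + 1) * (2 * real k * R\<^sup>2 + 1) * 1"
        by (simp add: algebra_simps)
      also have "\<dots> \<le> (real k + 1) * (2 * real k * R\<^sup>2 + 1) * (\<alpha> powr (1/2) + \<Delta> powr (2/9))"
        using ge_one_powr_ge_zero[of \<alpha> "1/2"] False
        by (intro mult_left_mono) (auto intro: add_increasing2)
      finally show ?thesis
        using l by blast
    qed
  next
    case False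
    then have "A + C \<noteq> 0" by auto
    then obtain p m where pm: "\<And>y z. \<bar>(A * relu z + C * relu (- z)) - (p * relu y - m * relu (- y))\<bar>
        \<le> (\<bar>A\<bar> + \<bar>C\<bar>) / \<bar>A + C\<bar> * \<bar>y - (A + C) * z\<bar>"
      using two_piece_rescale by metis
    define G where "G x = p * relu (dot d vs x - bs) - m * relu (- (dot d vs x - bs))" for x
    let ?K = "\<bar>A\<bar> + \<bar>C\<bar>"
    \<comment> \<open>The summand 1 accounts for passing from \<open>F\<close> to \<open>H\<close>,
      the quotient for passing from \<open>H\<close> to \<open>G\<close>.\<close>
    have "\<bar>F x - G x\<bar> \<le> (1 + ?K / \<bar>A + C\<bar>) * (\<Sum>i<k. \<bar>dot d (w i) x - e i\<bar>)" for x
    proof -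
      have "\<bar>H x - G x\<bar> \<le> ?K / \<bar>A + C\<bar> * \<bar>(dot d vs x - bs) - (A + C) * (dot d u x - c)\<bar>"
        unfolding H_def G_def by (rule pm)
      also have "\<dots> \<le> ?K / \<bar>A + C\<bar> * (\<Sum>i<k. \<bar>dot d (w i) x - e i\<bar>)"
        by (intro mult_left_mono lin) auto
      finally show ?thesis
        using FH[of x] by (simp add: distrib_right)
    qed
    then have "(gauss_norm d (\<lambda>x. F x - G x))\<^sup>2
        \<le> (1 + ?K / \<bar>A + C\<bar>)\<^sup>2 * real k * (\<Sum>i<k. 2 * R\<^sup>2 * (\<Delta>\<^sup>2 + \<alpha>\<^sup>2))"
      by (rule gauss_norm_sq_le) (rule w_le)
    also have "\<dots> = (1 + ?K / \<bar>A + C\<bar>)\<^sup>2 * real k * (real k * (2 * R\<^sup>2 * (\<Delta>\<^sup>2 + \<alpha>\<^sup>2)))"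
      by simp
    also have "\<dots> \<le> 4 * (1 + (real k)\<^sup>2 * R\<^sup>2) * (real k)\<^sup>2 * R\<^sup>2
        * (\<Delta> powr (2/5) + \<alpha>\<^sup>2 * \<Delta> powr (- (4/9)))"
    proof (rule bound_large_slope)
      have sum_le: "\<bar>\<Sum>i\<in>I. s i * r i\<bar> \<le> (\<Sum>i\<in>I. r i)" if "I \<subseteq> {..<k}" for I
        using that s r by (intro order_trans[OF sum_abs] sum_mono) (auto simp: abs_mult less_imp_le)
      have "?K \<le> (\<Sum>i\<in>S. r i) + (\<Sum>i\<in>S'. r i)"
        unfolding A_def C_def using SS'(1) by (intro add_mono sum_le) auto
      also have "\<dots> = (\<Sum>i<k. r i)"
        using sum.union_disjoint[OF fin SS'(2), of r] SS'(1) by simp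
      also have "\<dots> \<le> (\<Sum>i<k. R)"
        using R by (intro sum_mono) (auto simp: r_def)
      finally show "?K \<le> real k * R" by simp
    qed (use \<Delta> False in auto)
    finally show ?thesis
      unfolding G_def by blast
  qed
qed

section \<open>Choice of the absolute polynomial\<close>

theorem lemma3p21:
  shows "\<exists>P :: real poly poly poly.
    \<forall>(d :: nat) (k :: nat) (v :: nat \<Rightarrow> nat \<Rightarrow> real) (b :: nat \<Rightarrow> real) (s :: nat \<Rightarrow> real)
     (\<Delta> :: real) (\<alpha> :: real) (S\<^sub>1 :: nat set) (S\<^sub>2 :: nat set).
      0 < \<Delta> \<longrightarrow> \<Delta> < sqrt 2 / 2 \<longrightarrow> 0 < \<alpha> \<longrightarrow> 1 \<le> k \<longrightarrow>
      (\<forall>i<k. nonzero_vec d (v i)) \<longrightarrow>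
      pairwise (\<lambda>i j. close d \<Delta> \<alpha> (v i, b i) (v j, b j)) {..<k} \<longrightarrow>
      is_orientation d k v S\<^sub>1 S\<^sub>2 \<longrightarrow>
      (\<forall>i<k. s i \<in> {1, -1}) \<longrightarrow>
      (let B = Max ((\<lambda>i. \<bar>b i\<bar>) ` {..<k});
           R = Max ((\<lambda>i. vnorm d (v i)) ` {..<k});
           F = (\<lambda>x. \<Sum>i<k. s i * relu (dot d (v i) x - b i));
           vs = (\<lambda>j. (\<Sum>i\<in>S\<^sub>1. s i * v i j) - (\<Sum>i\<in>S\<^sub>2. s i * v i j));
           bs = (\<Sum>i\<in>S\<^sub>1. s i * b i) - (\<Sum>i\<in>S\<^sub>2. s i * b i)
       in
        (\<exists>l. affine_linear d l \<and>
           (gauss_norm d (\<lambda>x. F x - l x))\<^sup>2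
             \<le> poly3 P (real k) R B * (\<alpha> powr (1/2) + \<Delta> powr (2/9))) \<or>
        (\<exists>a\<^sub>p a\<^sub>m :: real.
           let G = (\<lambda>x. a\<^sub>p * relu (dot d vs x - bs) - a\<^sub>m * relu (dot d (\<lambda>j. - vs j) x + bs))
           in (gauss_norm d (\<lambda>x. F x - G x))\<^sup>2
             \<le> poly3 P (real k) R B * (\<Delta> powr (2/5) + \<alpha>\<^sup>2 * \<Delta> powr (- (4/9)))))"
proof -
  \<comment> \<open>Under \<open>poly3\<close>, \<open>X\<close> evaluates to the first argument and
    \<open>Y\<close> to the second, that is, to \<open>k\<close> and \<open>R\<close>.\<close>
  define X Y :: "real poly poly poly" where "X = [:0, 1:]" and "Y = [:[:0, 1:]:]"
  \<comment> \<open>The sum of the two explicit bounds dominates each of them, as both are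
    nonnegative at \<open>real k\<close>.\<close>
  define P where "P = (X + 1) * (2 * X * Y\<^sup>2 + 1) + 4 * (1 + X\<^sup>2 * Y\<^sup>2) * X\<^sup>2 * Y\<^sup>2"
  let ?p = "\<lambda>x y. (x + 1) * (2 * x * y\<^sup>2 + 1) :: real"
  let ?q = "\<lambda>x y. 4 * (1 + x\<^sup>2 * y\<^sup>2) * x\<^sup>2 * y\<^sup>2 :: real"
  have P: "poly3 P x y z = ?p x y + ?q x y" for x y z
    by (simp add: poly3_def P_def X_def Y_def)
  show ?thesis
    unfolding Let_def
  proof (intro exI[of _ P] allI impI)
    fix d k :: nat and v :: "nat \<Rightarrow> nat \<Rightarrow> real" and b s :: "nat \<Rightarrow> real" and \<Delta> \<alpha> :: real
      and S\<^sub>1 S\<^sub>2 :: "nat set"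
    assume asm: "0 < \<Delta>" "\<Delta> < sqrt 2 / 2" "0 < \<alpha>" "1 \<le> k" "\<forall>i<k. nonzero_vec d (v i)"
      "pairwise (\<lambda>i j. close d \<Delta> \<alpha> (v i, b i) (v j, b j)) {..<k}"
      "is_orientation d k v S\<^sub>1 S\<^sub>2" "\<forall>i<k. s i \<in> {1, -1}"
    let ?R = "Max ((\<lambda>i. vnorm d (v i)) ` {..<k})"
    let ?B = "Max ((\<lambda>i. \<bar>b i\<bar>) ` {..<k})"
    let ?F = "\<lambda>x. \<Sum>i<k. s i * relu (dot d (v i) x - b i)"
    let ?vs = "\<lambda>j. (\<Sum>i\<in>S\<^sub>1. s i * v i j) - (\<Sum>i\<in>S\<^sub>2. s i * v i j)"
    let ?bs = "(\<Sum>i\<in>S\<^sub>1. s i * b i) - (\<Sum>i\<in>S\<^sub>2. s i * b i)"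
    let ?a = "\<alpha> powr (1/2) + \<Delta> powr (2/9)"
    let ?c = "\<Delta> powr (2/5) + \<alpha>\<^sup>2 * \<Delta> powr (- (4/9))"
    have "\<Delta> \<le> 1"
      using asm(2) sqrt2_less_2 by linarith
    then have main: "(\<exists>l. affine_linear d l \<and>
        (gauss_norm d (\<lambda>x. ?F x - l x))\<^sup>2 \<le> ?p (real k) ?R * ?a) \<or>
      (\<exists>p m. (gauss_norm d (\<lambda>x. ?F x
          - (p * relu (dot d ?vs x - ?bs) - m * relu (- (dot d ?vs x - ?bs)))))\<^sup>2
        \<le> ?q (real k) ?R * ?c)"
      using asm by (intro close_relu_network_approx) (auto intro!: Max_ge)
    have neg: "- (dot d ?vs x - ?bs) = dot d (\<lambda>j. - ?vs j) x + ?bs" for x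
      using dot_lincomb_left[of d 0 ?vs 1 ?vs x] by simp
    have p_le: "?p (real k) ?R * ?a \<le> poly3 P (real k) ?R ?B * ?a"
      unfolding P by (intro mult_right_mono) auto
    have q_le: "?q (real k) ?R * ?c \<le> poly3 P (real k) ?R ?B * ?c"
      unfolding P by (intro mult_right_mono) auto
    show "(\<exists>l. affine_linear d l \<and>
        (gauss_norm d (\<lambda>x. ?F x - l x))\<^sup>2 \<le> poly3 P (real k) ?R ?B * ?a) \<or>
      (\<exists>a\<^sub>p a\<^sub>m. (gauss_norm d (\<lambda>x. ?F x
          - (a\<^sub>p * relu (dot d ?vs x - ?bs) - a\<^sub>m * relu (dot d (\<lambda>j. - ?vs j) x + ?bs))))\<^sup>2
        \<le> poly3 P (real k) ?R ?B * ?c)"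
      using main[unfolded neg]
    proof
      assume "\<exists>l. affine_linear d l \<and>
        (gauss_norm d (\<lambda>x. ?F x - l x))\<^sup>2 \<le> ?p (real k) ?R * ?a"
      then show ?thesis
        by (elim exE conjE) (intro disjI1 exI conjI, assumption, erule order_trans[OF _ p_le])
    next
      assume "\<exists>p m. (gauss_norm d (\<lambda>x. ?F x
          - (p * relu (dot d ?vs x - ?bs) - m * relu (dot d (\<lambda>j. - ?vs j) x + ?bs))))\<^sup>2
        \<le> ?q (real k) ?R * ?c"
      then show ?thesis
        by (elim exE) (intro disjI2 exI, erule order_trans[OF _ q_le])
    qed
  qed
qed

end
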